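(* The Markov categories $\mathbf{FinSet}$ and $\mathbf{FinSetMulti}$ have conditionals.
   Context: A Markov category is a symmetric monoidal category $(\mathbf{C},\otimes,I)$ in which every object $X$ carries a commutative comonoid structure $\mathsf{copy}_X:X\to X\otimes X$, $\mathsf{del}_X:X\to I$, compatible with the monoidal structure and with $\mathsf{del}$ natural ($\mathsf{del}_Y\circ f=\mathsf{del}_X$ for all $f:X\to Y$). $\mathbf{C}$ has conditionals if for every morphism $f:A\to X\otimes Y$ there is a morphism $f_{|X}:X\otimes A\to Y$ with $$f=(\mathrm{id}_X\otimes f_{|X})\circ(\mathsf{copy}_X\otimes\mathrm{id}_A)\circ(f_X\otimes \mathrm{id}_A)\circ\mathsf{copy}_A,$$ where $f_X=(\mathrm{id}_X\otimes\mathsf{del}_Y)\circ f$ is the marginal of $f$ on $X$. $\mathbf{FinSet}$: objects are finite sets, morphisms are functions, $\otimes$ is the Cartesian product, $I$ is a one-element set, $\mathsf{copy}_X(x)=(x,x)$, and $\mathsf{del}_X:X\to I$ is the unique map. $\mathbf{FinSetMulti}$: objects are finite sets; a morphism $f:X\to Y$ is a matrix $(f(y\mid x))_{y\in Y,x\in X}$ with entries in $\{0,1\}$ such that for every $x\in X$ there is some $y\in Y$ with $f(y\mid x)=1$; composition is $(g\circ f)(z\mid x)=\sum_{y}g(z\mid y)\,f(y\mid x)$ with the convention $1+1=1$; $\otimes$ is the Cartesian product on objects and $(f\otimes g)(y,y'\mid x,x')=f(y\mid x)\,g(y'\mid x')$ on morphisms; $\mathsf{copy}_X$ and $\mathsf{del}_X$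 are the $\{0,1\}$-matrices of the functions $x\mapsto(x,x)$ and $X\to I$. *)

theory Defs
  imports "HOL-Library.FuncSet"
begin

section \<open>Markov categories\<close>

text \<open>
  Each arrow determines its domain and codomain. The operations are total functions in HOL;
  nothing is required of the composite of arrows that are not composable.
\<close>

record ('o, 'm) markov_data =
  Ob :: "'o set"
  Arr :: "'m set"
  Dom :: "'m \<Rightarrow> 'o"
  Cod :: "'m \<Rightarrow> 'o"
  Id :: "'o \<Rightarrow> 'm" ("id\<index>")
  Comp :: "'m \<Rightarrow> 'm \<Rightarrow> 'm" (infixr "\<cdot>\<index>" 55)
  Tensor_ob :: "'o \<Rightarrow> 'o \<Rightarrow> 'o" (infixr "\<otimes>\<index>" 70)
  Tensor_arr :: "'m \<Rightarrow> 'm \<Rightarrow> 'm" (infixr "\<otimes>\<^sub>m\<index>" 70)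
  Unit :: 'o ("I\<index>")
  Assoc :: "'o \<Rightarrow> 'o \<Rightarrow> 'o \<Rightarrow> 'm" ("\<alpha>\<index>")
  Lunit :: "'o \<Rightarrow> 'm" ("lunit\<index>")
  Runit :: "'o \<Rightarrow> 'm" ("runit\<index>")
  Sym :: "'o \<Rightarrow> 'o \<Rightarrow> 'm" ("\<sigma>\<index>")
  Copy :: "'o \<Rightarrow> 'm" ("copy\<index>")
  Del :: "'o \<Rightarrow> 'm" ("del\<index>")

definition Hom :: "('o, 'm, 'z) markov_data_scheme \<Rightarrow> 'o \<Rightarrow> 'o \<Rightarrow> 'm set" ("Hom\<index>") where
  "Hom\<^bsub>C\<^esub> X Y = {f \<in> Arr C. Dom C f = X \<and> Cod C f = Y}"

definition Inverse_arrows :: "('o, 'm, 'z) markov_data_scheme \<Rightarrow> 'm \<Rightarrow> 'm \<Rightarrow> bool" where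
  "Inverse_arrows C f g \<longleftrightarrow>
     g \<in> Hom\<^bsub>C\<^esub> (Cod C f) (Dom C f) \<and>
     g \<cdot>\<^bsub>C\<^esub> f = id\<^bsub>C\<^esub> (Dom C f) \<and> f \<cdot>\<^bsub>C\<^esub> g = id\<^bsub>C\<^esub> (Cod C f)"

definition Iso :: "('o, 'm, 'z) markov_data_scheme \<Rightarrow> 'm \<Rightarrow> bool" where
  "Iso C f \<longleftrightarrow> f \<in> Arr C \<and> (\<exists>g. Inverse_arrows C f g)"

definition Inv :: "('o, 'm, 'z) markov_data_scheme \<Rightarrow> 'm \<Rightarrow> 'm" ("Inv\<index>") where
  "Inv\<^bsub>C\<^esub> f = (THE g. Inverse_arrows C f g)"

locale category =
  fixes C :: "('o, 'm, 'z) markov_data_scheme" (structure)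
  assumes dom_ob: "f \<in> Arr C \<Longrightarrow> Dom C f \<in> Ob C"
    and cod_ob: "f \<in> Arr C \<Longrightarrow> Cod C f \<in> Ob C"
    and id_hom: "X \<in> Ob C \<Longrightarrow> id X \<in> Hom X X"
    and comp_hom: "\<lbrakk>f \<in> Hom X Y; g \<in> Hom Y Z\<rbrakk> \<Longrightarrow> g \<cdot> f \<in> Hom X Z"
    and comp_id: "f \<in> Hom X Y \<Longrightarrow> f \<cdot> id X = f"
    and id_comp: "f \<in> Hom X Y \<Longrightarrow> id Y \<cdot> f = f"
    and comp_assoc: "\<lbrakk>f \<in> Hom W X; g \<in> Hom X Y; h \<in> Hom Y Z\<rbrakk> \<Longrightarrow> (h \<cdot> g) \<cdot> f = h \<cdot> (g \<cdot> f)"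

locale symmetric_monoidal_category = category +
  assumes tensor_ob: "\<lbrakk>X \<in> Ob C; Y \<in> Ob C\<rbrakk> \<Longrightarrow> X \<otimes> Y \<in> Ob C"
    and unit_ob: "I \<in> Ob C"
    and tensor_hom: "\<lbrakk>f \<in> Hom X Y; g \<in> Hom X' Y'\<rbrakk> \<Longrightarrow> f \<otimes>\<^sub>m g \<in> Hom (X \<otimes> X') (Y \<otimes> Y')"
    and tensor_id: "\<lbrakk>X \<in> Ob C; Y \<in> Ob C\<rbrakk> \<Longrightarrow> id X \<otimes>\<^sub>m id Y = id (X \<otimes> Y)"
    and interchange: "\<lbrakk>f \<in> Hom X Y; g \<in> Hom Y Z; f' \<in> Hom X' Y'; g' \<in> Hom Y' Z'\<rbrakk> \<Longrightarrow>
        (g \<cdot> f) \<otimes>\<^sub>m (g' \<cdot> f') = (g \<otimes>\<^sub>m g') \<cdot> (f \<otimes>\<^sub>m f')"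
    and assoc_hom: "\<lbrakk>X \<in> Ob C; Y \<in> Ob C; Z \<in> Ob C\<rbrakk> \<Longrightarrow>
        \<alpha> X Y Z \<in> Hom ((X \<otimes> Y) \<otimes> Z) (X \<otimes> (Y \<otimes> Z))"
    and assoc_iso: "\<lbrakk>X \<in> Ob C; Y \<in> Ob C; Z \<in> Ob C\<rbrakk> \<Longrightarrow> Iso C (\<alpha> X Y Z)"
    and assoc_natural: "\<lbrakk>f \<in> Hom X X'; g \<in> Hom Y Y'; h \<in> Hom Z Z'\<rbrakk> \<Longrightarrow>
        \<alpha> X' Y' Z' \<cdot> ((f \<otimes>\<^sub>m g) \<otimes>\<^sub>m h) = (f \<otimes>\<^sub>m (g \<otimes>\<^sub>m h)) \<cdot> \<alpha> X Y Z"
    and lunit_hom: "X \<in> Ob C \<Longrightarrow> lunit X \<in> Hom (I \<otimes> X) X"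
    and lunit_iso: "X \<in> Ob C \<Longrightarrow> Iso C (lunit X)"
    and lunit_natural: "f \<in> Hom X Y \<Longrightarrow> lunit Y \<cdot> (id I \<otimes>\<^sub>m f) = f \<cdot> lunit X"
    and runit_hom: "X \<in> Ob C \<Longrightarrow> runit X \<in> Hom (X \<otimes> I) X"
    and runit_iso: "X \<in> Ob C \<Longrightarrow> Iso C (runit X)"
    and runit_natural: "f \<in> Hom X Y \<Longrightarrow> runit Y \<cdot> (f \<otimes>\<^sub>m id I) = f \<cdot> runit X"
    and pentagon: "\<lbrakk>W \<in> Ob C; X \<in> Ob C; Y \<in> Ob C; Z \<in> Ob C\<rbrakk> \<Longrightarrow>
        \<alpha> W X (Y \<otimes> Z) \<cdot> \<alpha> (W \<otimes> X) Y Z =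
        (id W \<otimes>\<^sub>m \<alpha> X Y Z) \<cdot> \<alpha> W (X \<otimes> Y) Z \<cdot> (\<alpha> W X Y \<otimes>\<^sub>m id Z)"
    and triangle: "\<lbrakk>X \<in> Ob C; Y \<in> Ob C\<rbrakk> \<Longrightarrow>
        (id X \<otimes>\<^sub>m lunit Y) \<cdot> \<alpha> X I Y = runit X \<otimes>\<^sub>m id Y"
    and sym_hom: "\<lbrakk>X \<in> Ob C; Y \<in> Ob C\<rbrakk> \<Longrightarrow> \<sigma> X Y \<in> Hom (X \<otimes> Y) (Y \<otimes> X)"
    and sym_natural: "\<lbrakk>f \<in> Hom X X'; g \<in> Hom Y Y'\<rbrakk> \<Longrightarrow>
        \<sigma> X' Y' \<cdot> (f \<otimes>\<^sub>m g) = (g \<otimes>\<^sub>m f) \<cdot> \<sigma> X Y"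
    and sym_sym: "\<lbrakk>X \<in> Ob C; Y \<in> Ob C\<rbrakk> \<Longrightarrow> \<sigma> Y X \<cdot> \<sigma> X Y = id (X \<otimes> Y)"
    and hexagon: "\<lbrakk>X \<in> Ob C; Y \<in> Ob C; Z \<in> Ob C\<rbrakk> \<Longrightarrow>
        \<alpha> Y Z X \<cdot> \<sigma> X (Y \<otimes> Z) \<cdot> \<alpha> X Y Z =
        (id Y \<otimes>\<^sub>m \<sigma> X Z) \<cdot> \<alpha> Y X Z \<cdot> (\<sigma> X Y \<otimes>\<^sub>m id Z)"

text \<open>The canonical isomorphism from \<open>(W \<otimes> X) \<otimes> (Y \<otimes> Z)\<close> to \<open>(W \<otimes> Y) \<otimes> (X \<otimes> Z)\<close>.\<close>

definition Middle_swap ::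
  "('o, 'm, 'z) markov_data_scheme \<Rightarrow> 'o \<Rightarrow> 'o \<Rightarrow> 'o \<Rightarrow> 'o \<Rightarrow> 'm" ("\<mu>\<index>") where
  "\<mu>\<^bsub>C\<^esub> W X Y Z =
     Inv\<^bsub>C\<^esub> (\<alpha>\<^bsub>C\<^esub> W Y (X \<otimes>\<^bsub>C\<^esub> Z)) \<cdot>\<^bsub>C\<^esub>
     (id\<^bsub>C\<^esub> W \<otimes>\<^sub>m\<^bsub>C\<^esub>
       (\<alpha>\<^bsub>C\<^esub> Y X Z \<cdot>\<^bsub>C\<^esub> (\<sigma>\<^bsub>C\<^esub> X Y \<otimes>\<^sub>m\<^bsub>C\<^esub> id\<^bsub>C\<^esub> Z) \<cdot>\<^bsub>C\<^esub> Inv\<^bsub>C\<^esub> (\<alpha>\<^bsub>C\<^esub> X Y Z))) \<cdot>\<^bsub>C\<^esub>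
     \<alpha>\<^bsub>C\<^esub> W X (Y \<otimes>\<^bsub>C\<^esub> Z)"

locale markov_category = symmetric_monoidal_category +
  assumes copy_hom: "X \<in> Ob C \<Longrightarrow> copy X \<in> Hom X (X \<otimes> X)"
    and del_hom: "X \<in> Ob C \<Longrightarrow> del X \<in> Hom X I"
    and copy_coassoc: "X \<in> Ob C \<Longrightarrow>
        \<alpha> X X X \<cdot> (copy X \<otimes>\<^sub>m id X) \<cdot> copy X = (id X \<otimes>\<^sub>m copy X) \<cdot> copy X"
    and copy_lcounit: "X \<in> Ob C \<Longrightarrow> lunit X \<cdot> (del X \<otimes>\<^sub>m id X) \<cdot> copy X = id X"
    and copy_rcounit: "X \<in> Ob C \<Longrightarrow> runit X \<cdot> (id X \<otimes>\<^sub>m del X) \<cdot> copy X = id X"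
    and copy_commute: "X \<in> Ob C \<Longrightarrow> \<sigma> X X \<cdot> copy X = copy X"
    and copy_tensor: "\<lbrakk>X \<in> Ob C; Y \<in> Ob C\<rbrakk> \<Longrightarrow>
        copy (X \<otimes> Y) = \<mu> X X Y Y \<cdot> (copy X \<otimes>\<^sub>m copy Y)"
    and del_tensor: "\<lbrakk>X \<in> Ob C; Y \<in> Ob C\<rbrakk> \<Longrightarrow>
        del (X \<otimes> Y) = lunit I \<cdot> (del X \<otimes>\<^sub>m del Y)"
    and copy_unit: "lunit I \<cdot> copy I = id I"
    and del_unit: "del I = id I"
    and del_natural: "f \<in> Hom X Y \<Longrightarrow> del Y \<cdot> f = del X"

definition Marginal :: "('o, 'm, 'z) markov_data_scheme \<Rightarrow> 'o \<Rightarrow> 'o \<Rightarrow> 'm \<Rightarrow> 'm" where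
  "Marginal C X Y f = runit\<^bsub>C\<^esub> X \<cdot>\<^bsub>C\<^esub> (id\<^bsub>C\<^esub> X \<otimes>\<^sub>m\<^bsub>C\<^esub> del\<^bsub>C\<^esub> Y) \<cdot>\<^bsub>C\<^esub> f"

definition has_conditionals :: "('o, 'm, 'z) markov_data_scheme \<Rightarrow> bool" where
  "has_conditionals C \<longleftrightarrow>
     (\<forall>A \<in> Ob C. \<forall>X \<in> Ob C. \<forall>Y \<in> Ob C. \<forall>f \<in> Hom\<^bsub>C\<^esub> A (X \<otimes>\<^bsub>C\<^esub> Y).
        \<exists>k \<in> Hom\<^bsub>C\<^esub> (X \<otimes>\<^bsub>C\<^esub> A) Y.
          f = (id\<^bsub>C\<^esub> X \<otimes>\<^sub>m\<^bsub>C\<^esub> k) \<cdot>\<^bsub>C\<^esub> \<alpha>\<^bsub>C\<^esub> X X A \<cdot>\<^bsub>C\<^esub> (copy\<^bsub>C\<^esub> X \<otimes>\<^sub>m\<^bsub>C\<^esub> id\<^bsub>C\<^esub> A) \<cdot>\<^bsub>C\<^esub>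
              (Marginal C X Y f \<otimes>\<^sub>m\<^bsub>C\<^esub> id\<^bsub>C\<^esub> A) \<cdot>\<^bsub>C\<^esub> copy\<^bsub>C\<^esub> A)"


section \<open>Finite sets\<close>

text \<open>
  A type of objects must contain the Cartesian product of any two of its members. Hence the
  objects below are the finite sets of elements of the universe freely generated by a point and
  pairing from an arbitrary type of atoms; every finite set \<open>S :: 'a set\<close> occurs as \<open>Atom ` S\<close>.
\<close>

datatype 'a elt = Atom 'a | Point | Pr (pfst: "'a elt") (psnd: "'a elt")

definition cart :: "'a elt set \<Rightarrow> 'a elt set \<Rightarrow> 'a elt set" (infixr "\<times>\<^sub>e" 80) where
  "X \<times>\<^sub>e Y = {Pr x y | x y. x \<in> X \<and> y \<in> Y}"

text \<open>The underlying maps of the structure morphisms, restricted to their domains later.\<close>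

definition assoc_map :: "'a elt \<Rightarrow> 'a elt" where
  "assoc_map p = Pr (pfst (pfst p)) (Pr (psnd (pfst p)) (psnd p))"

definition swap_map :: "'a elt \<Rightarrow> 'a elt" where
  "swap_map p = Pr (psnd p) (pfst p)"

definition copy_map :: "'a elt \<Rightarrow> 'a elt" where
  "copy_map x = Pr x x"

datatype ('o, 'd) arrow = Arrow (src: 'o) (tgt: 'o) (rep: 'd)


section \<open>The category of finite sets and functions\<close>

type_synonym 'a fun_arrow = "('a elt set, 'a elt \<Rightarrow> 'a elt) arrow"

definition Fun :: "'a elt set \<Rightarrow> 'a elt set \<Rightarrow> ('a elt \<Rightarrow> 'a elt) \<Rightarrow> 'a fun_arrow" where
  "Fun X Y h = Arrow X Y (restrict h X)"

definition FinSet :: "('a elt set, 'a fun_arrow) markov_data" where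
  "FinSet = \<lparr>
     Ob = {X. finite X},
     Arr = {Arrow X Y f | X Y f. finite X \<and> finite Y \<and> f \<in> X \<rightarrow>\<^sub>E Y},
     Dom = src,
     Cod = tgt,
     Id = (\<lambda>X. Fun X X (\<lambda>x. x)),
     Comp = (\<lambda>g f. Fun (src f) (tgt g) (rep g \<circ> rep f)),
     Tensor_ob = (\<times>\<^sub>e),
     Tensor_arr = (\<lambda>f g. Fun (src f \<times>\<^sub>e src g) (tgt f \<times>\<^sub>e tgt g)
                           (\<lambda>p. Pr (rep f (pfst p)) (rep g (psnd p)))),
     Unit = {Point},
     Assoc = (\<lambda>X Y Z. Fun ((X \<times>\<^sub>e Y) \<times>\<^sub>e Z) (X \<times>\<^sub>e (Y \<times>\<^sub>e Z)) assoc_map),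
     Lunit = (\<lambda>X. Fun ({Point} \<times>\<^sub>e X) X psnd),
     Runit = (\<lambda>X. Fun (X \<times>\<^sub>e {Point}) X pfst),
     Sym = (\<lambda>X Y. Fun (X \<times>\<^sub>e Y) (Y \<times>\<^sub>e X) swap_map),
     Copy = (\<lambda>X. Fun X (X \<times>\<^sub>e X) copy_map),
     Del = (\<lambda>X. Fun X {Point} (\<lambda>_. Point))\<rparr>"


section \<open>The category of finite sets and multivalued functions\<close>

text \<open>The semiring with elements 0 and 1 in which 1 + 1 = 1.\<close>

datatype boole = Zero | One

instantiation boole :: comm_semiring_1
begin

definition zero_boole :: boole where "0 = Zero"

definition one_boole :: boole where "1 = One"

fun plus_boole :: "boole \<Rightarrow> boole \<Rightarrow> boole" where
  "Zero + b = b"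
| "One + b = One"

fun times_boole :: "boole \<Rightarrow> boole \<Rightarrow> boole" where
  "Zero * b = Zero"
| "One * b = b"

instance
proof
  fix a b c :: boole
  show "a + b + c = a + (b + c)" by (cases a) simp_all
  show "a + b = b + a" by (cases a; cases b) simp_all
  show "0 + a = a" by (simp add: zero_boole_def)
  show "a * b * c = a * (b * c)" by (cases a) simp_all
  show "a * b = b * a" by (cases a; cases b) simp_all
  show "1 * a = a" by (simp add: one_boole_def)
  show "(a + b) * c = a * c + b * c" by (cases a; cases b; cases c) simp_all
  show "0 * a = 0" by (simp add: zero_boole_def)
  show "a * 0 = 0" by (cases a) (simp_all add: zero_boole_def)
  show "(0::boole) \<noteq> 1" by (simp add: zero_boole_def one_boole_def)
qed

end

text \<open>
  The matrix of a morphism \<open>X \<rightarrow> Y\<close> has the entry \<open>f y x\<close> for \<open>f(y | x)\<close>, with \<open>y \<in> Y\<close> and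
  \<open>x \<in> X\<close>. It is represented by a function that is 0 off \<open>Y \<times> X\<close>, so that equality of arrows is
  equality of matrices.
\<close>

type_synonym 'a mat_arrow = "('a elt set, 'a elt \<Rightarrow> 'a elt \<Rightarrow> boole) arrow"

definition Mat :: "'a elt set \<Rightarrow> 'a elt set \<Rightarrow> ('a elt \<Rightarrow> 'a elt \<Rightarrow> boole) \<Rightarrow> 'a mat_arrow" where
  "Mat X Y m = Arrow X Y (\<lambda>y x. if y \<in> Y \<and> x \<in> X then m y x else 0)"

definition Graph :: "'a elt set \<Rightarrow> 'a elt set \<Rightarrow> ('a elt \<Rightarrow> 'a elt) \<Rightarrow> 'a mat_arrow" where
  "Graph X Y h = Mat X Y (\<lambda>y x. if y = h x then 1 else 0)"

definition FinSetMulti :: "('a elt set, 'a mat_arrow) markov_data" where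
  "FinSetMulti = \<lparr>
     Ob = {X. finite X},
     Arr = {Arrow X Y f | X Y f. finite X \<and> finite Y \<and>
              (\<forall>y x. y \<notin> Y \<or> x \<notin> X \<longrightarrow> f y x = 0) \<and> (\<forall>x\<in>X. \<exists>y\<in>Y. f y x = 1)},
     Dom = src,
     Cod = tgt,
     Id = (\<lambda>X. Graph X X (\<lambda>x. x)),
     Comp = (\<lambda>g f. Mat (src f) (tgt g) (\<lambda>z x. \<Sum>y\<in>tgt f. rep g z y * rep f y x)),
     Tensor_ob = (\<times>\<^sub>e),
     Tensor_arr = (\<lambda>f g. Mat (src f \<times>\<^sub>e src g) (tgt f \<times>\<^sub>e tgt g)
                           (\<lambda>q p. rep f (pfst q) (pfst p) * rep g (psnd q) (psnd p))),
     Unit = {Point},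
     Assoc = (\<lambda>X Y Z. Graph ((X \<times>\<^sub>e Y) \<times>\<^sub>e Z) (X \<times>\<^sub>e (Y \<times>\<^sub>e Z)) assoc_map),
     Lunit = (\<lambda>X. Graph ({Point} \<times>\<^sub>e X) X psnd),
     Runit = (\<lambda>X. Graph (X \<times>\<^sub>e {Point}) X pfst),
     Sym = (\<lambda>X Y. Graph (X \<times>\<^sub>e Y) (Y \<times>\<^sub>e X) swap_map),
     Copy = (\<lambda>X. Graph X (X \<times>\<^sub>e X) copy_map),
     Del = (\<lambda>X. Graph X {Point} (\<lambda>_. Point))\<rparr>"

end

theory Submission
  imports Defs
begin

text \<open>
  The axioms of a Markov category are checked entrywise: an entry of a composite of
  \<open>{0,1}\<close>-matrices is \<open>1\<close> iff a chain of entries \<open>1\<close> exists, so composition in \<open>FinSetMulti\<close> is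
  composition of relations. For \<open>f : A \<rightarrow> X \<otimes> Y\<close> in \<open>FinSet\<close>, the conditional sends \<open>(x, a)\<close> to the
  second component of \<open>f a\<close>, whatever \<open>x\<close> is. In \<open>FinSetMulti\<close> it relates \<open>(x, a)\<close> to those \<open>y\<close>
  with \<open>f(x, y | a) = 1\<close> if there are any, and to all \<open>y\<close> otherwise; \<open>Y\<close> is then nonempty because
  \<open>f\<close> is total at \<open>a\<close>.
\<close>

section \<open>Inverses and products\<close>

text \<open>Two-sided inverses are unique, since h = (g f) h = g (f h) = g. This evaluates the
  definite description behind \<open>Inv\<close>, which enters the axiom for copying on a tensor
  product through the inverse associators in \<open>Middle_swap\<close>.\<close>

lemma (in category) Inv_eqI:
  assumes "f \<in> Arr C" "Inverse_arrows C f g"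
  shows "Inv f = g"
  unfolding Inv_def
proof (rule the_equality)
  fix h assume h: "Inverse_arrows C f h"
  let ?X = "Dom C f" and ?Y = "Cod C f"
  have f: "f \<in> Hom ?X ?Y" and g: "g \<in> Hom ?Y ?X" and hh: "h \<in> Hom ?Y ?X"
    using assms h by (auto simp: Hom_def Inverse_arrows_def)
  have "h = (g \<cdot> f) \<cdot> h"
    using assms(2) id_comp[OF hh] by (simp add: Inverse_arrows_def)
  also have "\<dots> = g \<cdot> (f \<cdot> h)"
    using comp_assoc[OF hh f g] .
  also have "\<dots> = g"
    using h comp_id[OF g] by (simp add: Inverse_arrows_def)
  finally show "h = g" .
qed (use assms in auto)

lemma mem_cart [simp]: "Pr x y \<in> X \<times>\<^sub>e Y \<longleftrightarrow> x \<in> X \<and> y \<in> Y"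
  by (auto simp: cart_def)

text \<open>Every point of a product has the form \<open>Pr x y\<close>. Once quantifiers range over
  components, \<open>pfst\<close> and \<open>psnd\<close> compute, and identities between structure
  maps become trivial.\<close>

lemma ball_cart [simp]: "(\<forall>p \<in> X \<times>\<^sub>e Y. P p) \<longleftrightarrow> (\<forall>x\<in>X. \<forall>y\<in>Y. P (Pr x y))"
  by (auto simp: cart_def)

lemma bex_cart [simp]: "(\<exists>p \<in> X \<times>\<^sub>e Y. P p) \<longleftrightarrow> (\<exists>x\<in>X. \<exists>y\<in>Y. P (Pr x y))"
  by (auto simp: cart_def)

lemma finite_cart [simp]: "finite X \<Longrightarrow> finite Y \<Longrightarrow> finite (X \<times>\<^sub>e Y)"
proof -
  assume "finite X" "finite Y"
  moreover have "X \<times>\<^sub>e Y = (\<lambda>(x, y). Pr x y) ` (X \<times> Y)"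
    by (auto simp: cart_def)
  ultimately show ?thesis by simp
qed

definition assoc_inv_map :: "'a elt \<Rightarrow> 'a elt" where
  "assoc_inv_map p = Pr (Pr (pfst p) (pfst (psnd p))) (psnd (psnd p))"

lemmas structure_maps = assoc_map_def assoc_inv_map_def swap_map_def copy_map_def


section \<open>Finite sets and functions\<close>

lemma Fun_sel [simp]: "src (Fun X Y h) = X" "tgt (Fun X Y h) = Y" "rep (Fun X Y h) = restrict h X"
  by (simp_all add: Fun_def)

text \<open>Restriction forgets the values outside the domain, so comparing arrows only requires
  comparing values on \<open>X\<close>. Each axiom thereby becomes a pointwise identity.\<close>

lemma Fun_eq_iff: "Fun X Y h = Fun X' Y' h' \<longleftrightarrow> X = X' \<and> Y = Y' \<and> (\<forall>x\<in>X. h x = h' x)"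
  unfolding Fun_def arrow.inject by (metis restrict_apply' restrict_ext)

text \<open>The equation \<open>f = Fun X Y (rep f)\<close> encodes extensionality: restricting
  \<open>rep f\<close> to \<open>X\<close> leaves it unchanged.\<close>

lemma FinSet_Hom:
  "f \<in> Hom\<^bsub>FinSet\<^esub> X Y \<longleftrightarrow>
     finite X \<and> finite Y \<and> src f = X \<and> tgt f = Y \<and> f = Fun X Y (rep f) \<and> (\<forall>x\<in>X. rep f x \<in> Y)"
proof -
  have "h \<in> extensional X \<longleftrightarrow> h = restrict h X" for h :: "'a elt \<Rightarrow> 'a elt"
    by (metis extensional_restrict restrict_extensional)
  then show ?thesis
    by (cases f) (auto simp: Hom_def FinSet_def Fun_def PiE_iff)
qed

lemma FinSet_HomD:
  assumes "f \<in> Hom\<^bsub>FinSet\<^esub> X Y"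
  shows "finite X" "finite Y" "src f = X" "tgt f = Y" "f = Fun X Y (rep f)"
    "\<And>x. x \<in> X \<Longrightarrow> rep f x \<in> Y"
  using assms FinSet_Hom by blast+

text \<open>The normal form \<open>f = Fun X Y (rep f)\<close> is left out because \<open>f\<close>
  recurs on its right side; it is applied by hand where a bare \<open>f\<close> must be
  expanded.\<close>

lemma FinSet_Hom_facts:
  "f \<in> Hom\<^bsub>FinSet\<^esub> X Y \<Longrightarrow>
     finite X \<and> finite Y \<and> src f = X \<and> tgt f = Y \<and> (\<forall>x\<in>X. rep f x \<in> Y)"
  by (simp add: FinSet_Hom)

lemma FinSet_Fun_Hom:
  "Fun X Y h \<in> Hom\<^bsub>FinSet\<^esub> X' Y' \<longleftrightarrow>
     X = X' \<and> Y = Y' \<and> finite X \<and> finite Y \<and> (\<forall>x\<in>X. h x \<in> Y)"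
  by (auto simp: FinSet_Hom Fun_eq_iff)

lemma FinSet_sel:
  "Ob FinSet = {X. finite X}" "Dom FinSet = src" "Cod FinSet = tgt"
  "id\<^bsub>FinSet\<^esub> X = Fun X X (\<lambda>x. x)"
  "g \<cdot>\<^bsub>FinSet\<^esub> f = Fun (src f) (tgt g) (rep g \<circ> rep f)"
  "X \<otimes>\<^bsub>FinSet\<^esub> Y = X \<times>\<^sub>e Y"
  "f \<otimes>\<^sub>m\<^bsub>FinSet\<^esub> g = Fun (src f \<times>\<^sub>e src g) (tgt f \<times>\<^sub>e tgt g)
                           (\<lambda>p. Pr (rep f (pfst p)) (rep g (psnd p)))"
  "I\<^bsub>FinSet\<^esub> = {Point}"
  "\<alpha>\<^bsub>FinSet\<^esub> X Y Z = Fun ((X \<times>\<^sub>e Y) \<times>\<^sub>e Z) (X \<times>\<^sub>e (Y \<times>\<^sub>e Z)) assoc_map"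
  "lunit\<^bsub>FinSet\<^esub> X = Fun ({Point} \<times>\<^sub>e X) X psnd"
  "runit\<^bsub>FinSet\<^esub> X = Fun (X \<times>\<^sub>e {Point}) X pfst"
  "\<sigma>\<^bsub>FinSet\<^esub> X Y = Fun (X \<times>\<^sub>e Y) (Y \<times>\<^sub>e X) swap_map"
  "copy\<^bsub>FinSet\<^esub> X = Fun X (X \<times>\<^sub>e X) copy_map"
  "del\<^bsub>FinSet\<^esub> X = Fun X {Point} (\<lambda>_. Point)"
  by (simp_all add: FinSet_def)

lemmas FinSet_simps = FinSet_sel FinSet_Fun_Hom Fun_eq_iff structure_maps

section \<open>The Markov category axioms for functions\<close>

interpretation FinSet: category FinSet
proof
  show "f \<in> Arr FinSet \<Longrightarrow> Dom FinSet f \<in> Ob FinSet" for f :: "'a fun_arrow"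
    by (auto simp: FinSet_def)
  show "f \<in> Arr FinSet \<Longrightarrow> Cod FinSet f \<in> Ob FinSet" for f :: "'a fun_arrow"
    by (auto simp: FinSet_def)
  \<comment> \<open>In both identity laws one side is a bare arrow. Its normal form makes both sides
    instances of \<open>Fun\<close>, to be compared pointwise.\<close>
  show "f \<cdot>\<^bsub>FinSet\<^esub> id\<^bsub>FinSet\<^esub> X = f" if "f \<in> Hom\<^bsub>FinSet\<^esub> X Y" for f :: "'a fun_arrow" and X Y
    by (rule trans[OF _ FinSet_HomD(5)[OF that, symmetric]]) (use FinSet_HomD(1-4,6)[OF that] in \<open>simp add: FinSet_simps\<close>)
  show "id\<^bsub>FinSet\<^esub> Y \<cdot>\<^bsub>FinSet\<^esub> f = f" if "f \<in> Hom\<^bsub>FinSet\<^esub> X Y" for f :: "'a fun_arrow" and X Y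
    by (rule trans[OF _ FinSet_HomD(5)[OF that, symmetric]]) (use FinSet_HomD(1-4,6)[OF that] in \<open>simp add: FinSet_simps\<close>)
qed (auto simp: FinSet_simps dest!: FinSet_Hom_facts)

text \<open>The pointwise identities are the two composition laws; uniqueness of inverses then
  identifies \<open>Inv\<close>.\<close>

lemma FinSet_isoI:
  assumes "finite X" "finite Y" "\<forall>x\<in>X. h x \<in> Y \<and> h' (h x) = x" "\<forall>y\<in>Y. h' y \<in> X \<and> h (h' y) = y"
  shows "Iso FinSet (Fun X Y h)" "Inv\<^bsub>FinSet\<^esub> (Fun X Y h) = Fun Y X h'"
proof -
  have "Fun X Y h \<in> Hom\<^bsub>FinSet\<^esub> X Y"
    using assms by (simp add: FinSet_simps)
  then have arr: "Fun X Y h \<in> Arr FinSet"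
    by (simp add: Hom_def)
  have inv: "Inverse_arrows FinSet (Fun X Y h) (Fun Y X h')"
    using assms by (simp add: Inverse_arrows_def FinSet_simps)
  show "Iso FinSet (Fun X Y h)"
    using arr inv by (auto simp: Iso_def)
  show "Inv\<^bsub>FinSet\<^esub> (Fun X Y h) = Fun Y X h'"
    using arr inv by (rule FinSet.Inv_eqI)
qed

lemma FinSet_assoc_iso:
  assumes "finite X" "finite Y" "finite Z"
  shows "Iso FinSet (\<alpha>\<^bsub>FinSet\<^esub> X Y Z)"
    "Inv\<^bsub>FinSet\<^esub> (\<alpha>\<^bsub>FinSet\<^esub> X Y Z) = Fun (X \<times>\<^sub>e (Y \<times>\<^sub>e Z)) ((X \<times>\<^sub>e Y) \<times>\<^sub>e Z) assoc_inv_map"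
  unfolding FinSet_sel
  by (rule FinSet_isoI[where h' = assoc_inv_map]; simp add: assms structure_maps)+

interpretation FinSet: symmetric_monoidal_category FinSet
proof
  show "Iso FinSet (\<alpha>\<^bsub>FinSet\<^esub> X Y Z)"
    if "X \<in> Ob FinSet" "Y \<in> Ob FinSet" "Z \<in> Ob FinSet" for X Y Z :: "'a elt set"
    using that by (simp add: FinSet_assoc_iso FinSet_sel(1))
  show "Iso FinSet (lunit\<^bsub>FinSet\<^esub> X)" if "X \<in> Ob FinSet" for X :: "'a elt set"
    using that unfolding FinSet_sel by (intro FinSet_isoI[where h' = "Pr Point"]) auto
  show "Iso FinSet (runit\<^bsub>FinSet\<^esub> X)" if "X \<in> Ob FinSet" for X :: "'a elt set"
    using that unfolding FinSet_sel by (intro FinSet_isoI[where h' = "\<lambda>x. Pr x Point"]) auto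
qed (auto simp: FinSet_simps dest!: FinSet_Hom_facts)

interpretation FinSet: markov_category FinSet
proof
  show "copy\<^bsub>FinSet\<^esub> (X \<otimes>\<^bsub>FinSet\<^esub> Y) =
      \<mu>\<^bsub>FinSet\<^esub> X X Y Y \<cdot>\<^bsub>FinSet\<^esub> (copy\<^bsub>FinSet\<^esub> X \<otimes>\<^sub>m\<^bsub>FinSet\<^esub> copy\<^bsub>FinSet\<^esub> Y)"
    if "X \<in> Ob FinSet" "Y \<in> Ob FinSet" for X Y :: "'a elt set"
    using that unfolding Middle_swap_def
    \<comment> \<open>The inverse associators are evaluated first, while \<alpha> is still folded
      and matches \<open>FinSet_assoc_iso\<close>. Only then is everything unfolded to maps.\<close>
    by (simp add: FinSet_assoc_iso FinSet_sel(1,6)) (simp add: FinSet_simps)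
qed (auto simp: FinSet_simps dest!: FinSet_Hom_facts)

section \<open>Conditionals for functions\<close>

lemma FinSet_has_conditionals: "has_conditionals FinSet"
  unfolding has_conditionals_def
proof (intro ballI)
  fix A X Y :: "'a elt set" and f
  assume "f \<in> Hom\<^bsub>FinSet\<^esub> A (X \<otimes>\<^bsub>FinSet\<^esub> Y)"
    and fin: "A \<in> Ob FinSet" "X \<in> Ob FinSet" "Y \<in> Ob FinSet"
  then have f: "f \<in> Hom\<^bsub>FinSet\<^esub> A (X \<times>\<^sub>e Y)"
    by (simp add: FinSet_sel)
  \<comment> \<open>Splitting \<open>f\<close> into components: \<open>u\<close> is its marginal on
    \<open>X\<close>, and \<open>v\<close> yields the conditional.\<close>
  have "\<forall>a\<in>A. \<exists>x y. x \<in> X \<and> y \<in> Y \<and> rep f a = Pr x y"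
    using FinSet_HomD(6)[OF f] unfolding cart_def by blast
  then obtain u v where uv: "\<forall>a\<in>A. u a \<in> X \<and> v a \<in> Y \<and> rep f a = Pr (u a) (v a)"
    by metis
  let ?k = "Fun (X \<times>\<^sub>e A) Y (\<lambda>p. v (psnd p))"
  show "\<exists>k \<in> Hom\<^bsub>FinSet\<^esub> (X \<otimes>\<^bsub>FinSet\<^esub> A) Y.
      f = (id\<^bsub>FinSet\<^esub> X \<otimes>\<^sub>m\<^bsub>FinSet\<^esub> k) \<cdot>\<^bsub>FinSet\<^esub> \<alpha>\<^bsub>FinSet\<^esub> X X A \<cdot>\<^bsub>FinSet\<^esub>
        (copy\<^bsub>FinSet\<^esub> X \<otimes>\<^sub>m\<^bsub>FinSet\<^esub> id\<^bsub>FinSet\<^esub> A) \<cdot>\<^bsub>FinSet\<^esub>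
        (Marginal FinSet X Y f \<otimes>\<^sub>m\<^bsub>FinSet\<^esub> id\<^bsub>FinSet\<^esub> A) \<cdot>\<^bsub>FinSet\<^esub> copy\<^bsub>FinSet\<^esub> A"
  proof (rule bexI)
    show "?k \<in> Hom\<^bsub>FinSet\<^esub> (X \<otimes>\<^bsub>FinSet\<^esub> A) Y"
      using fin uv by (simp add: FinSet_simps)
    show "f = (id\<^bsub>FinSet\<^esub> X \<otimes>\<^sub>m\<^bsub>FinSet\<^esub> ?k) \<cdot>\<^bsub>FinSet\<^esub> \<alpha>\<^bsub>FinSet\<^esub> X X A \<cdot>\<^bsub>FinSet\<^esub>
        (copy\<^bsub>FinSet\<^esub> X \<otimes>\<^sub>m\<^bsub>FinSet\<^esub> id\<^bsub>FinSet\<^esub> A) \<cdot>\<^bsub>FinSet\<^esub>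
        (Marginal FinSet X Y f \<otimes>\<^sub>m\<^bsub>FinSet\<^esub> id\<^bsub>FinSet\<^esub> A) \<cdot>\<^bsub>FinSet\<^esub> copy\<^bsub>FinSet\<^esub> A"
      \<comment> \<open>At \<open>a\<close> the composite passes through \<open>Pr (u a) a\<close>,
        copies \<open>u a\<close>, and ends in \<open>Pr (u a) (v a)\<close>, which is
        \<open>rep f a\<close>.\<close>
      by (rule trans[OF FinSet_HomD(5)[OF f]])
        (use FinSet_HomD(1-4)[OF f] uv in \<open>simp add: FinSet_simps Marginal_def\<close>)
  qed
qed


section \<open>Finite sets and multivalued functions\<close>

lemma boole_eq_iff: "(a :: boole) = b \<longleftrightarrow> (a = 1 \<longleftrightarrow> b = 1)"
  by (cases a; cases b) (simp_all add: one_boole_def)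

lemma boole_mult_eq_1 [simp]: "(a :: boole) * b = 1 \<longleftrightarrow> a = 1 \<and> b = 1"
  by (cases a) (simp_all add: one_boole_def)

lemma boole_add_eq_1: "(a :: boole) + b = 1 \<longleftrightarrow> a = 1 \<or> b = 1"
  by (cases a) (simp_all add: one_boole_def)

text \<open>Addition is disjunction, so a finite sum is an existential quantifier. With
  multiplication as conjunction, an entry of a matrix product becomes the existence of an
  intermediate point. Finiteness matters: a sum over an infinite set is 0 by convention.\<close>

lemma boole_sum_eq_1 [simp]:
  "finite A \<Longrightarrow> (\<Sum>x\<in>A. h x) = (1 :: boole) \<longleftrightarrow> (\<exists>x\<in>A. h x = 1)"
  by (induction A rule: finite_induct) (auto simp: boole_add_eq_1)

lemma boole_if_eq_1 [simp]: "(if P then b else (0 :: boole)) = 1 \<longleftrightarrow> P \<and> b = 1"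
  by simp

section \<open>Matrices as arrows\<close>

lemma Mat_sel [simp]: "src (Mat X Y m) = X" "tgt (Mat X Y m) = Y"
  "rep (Mat X Y m) y x = (if y \<in> Y \<and> x \<in> X then m y x else 0)"
  by (simp_all add: Mat_def)

text \<open>Entries off \<open>Y\<close> and \<open>X\<close> are 0 on both sides, and an element of
  \<open>boole\<close> is determined by whether it is 1. Equality of arrows thus becomes an
  equivalence of propositions, suited to relational reasoning.\<close>

lemma Mat_eq_iff:
  "Mat X Y m = Mat X' Y' m' \<longleftrightarrow>
     X = X' \<and> Y = Y' \<and> (\<forall>x\<in>X. \<forall>y\<in>Y. m y x = 1 \<longleftrightarrow> m' y x = 1)"
proof
  assume eq: "Mat X Y m = Mat X' Y' m'"
  then have XY: "X = X'" "Y = Y'"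
    by (simp_all add: Mat_def)
  \<comment> \<open>Inside the index sets the truncation in \<open>Mat\<close> is invisible, so
    evaluating \<open>rep\<close> recovers the entries.\<close>
  have "m y x = m' y x" if "x \<in> X" "y \<in> Y" for x y
    using arg_cong[OF eq, of "\<lambda>f. rep f y x"] that XY by simp
  with XY show "X = X' \<and> Y = Y' \<and> (\<forall>x\<in>X. \<forall>y\<in>Y. m y x = 1 \<longleftrightarrow> m' y x = 1)"
    by simp
next
  assume eq: "X = X' \<and> Y = Y' \<and> (\<forall>x\<in>X. \<forall>y\<in>Y. m y x = 1 \<longleftrightarrow> m' y x = 1)"
  then have "\<forall>x\<in>X. \<forall>y\<in>Y. m y x = m' y x"
    using boole_eq_iff by blast
  with eq show "Mat X Y m = Mat X' Y' m'"
    by (simp add: Mat_def fun_eq_iff)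
qed

lemma FinSetMulti_Hom:
  "f \<in> Hom\<^bsub>FinSetMulti\<^esub> X Y \<longleftrightarrow>
     finite X \<and> finite Y \<and> src f = X \<and> tgt f = Y \<and> f = Mat X Y (rep f) \<and>
     (\<forall>x\<in>X. \<exists>y\<in>Y. rep f y x = 1)"
  by (cases f) (auto simp: Hom_def FinSetMulti_def Mat_def fun_eq_iff)

lemma FinSetMulti_HomD:
  assumes "f \<in> Hom\<^bsub>FinSetMulti\<^esub> X Y"
  shows "finite X" "finite Y" "src f = X" "tgt f = Y" "f = Mat X Y (rep f)"
    "\<forall>x\<in>X. \<exists>y\<in>Y. rep f y x = 1"
  using assms FinSetMulti_Hom by blast+

lemma FinSetMulti_Hom_facts:
  "f \<in> Hom\<^bsub>FinSetMulti\<^esub> X Y \<Longrightarrow>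
     finite X \<and> finite Y \<and> src f = X \<and> tgt f = Y \<and> (\<forall>x\<in>X. \<exists>y\<in>Y. rep f y x = 1)"
  by (simp add: FinSetMulti_Hom)

lemma FinSetMulti_Mat_Hom:
  "Mat X Y m \<in> Hom\<^bsub>FinSetMulti\<^esub> X' Y' \<longleftrightarrow>
     X = X' \<and> Y = Y' \<and> finite X \<and> finite Y \<and> (\<forall>x\<in>X. \<exists>y\<in>Y. m y x = 1)"
  by (auto simp: FinSetMulti_Hom Mat_eq_iff)

lemma FinSetMulti_sel:
  "Ob FinSetMulti = {X. finite X}" "Dom FinSetMulti = src" "Cod FinSetMulti = tgt"
  "id\<^bsub>FinSetMulti\<^esub> X = Graph X X (\<lambda>x. x)"
  "g \<cdot>\<^bsub>FinSetMulti\<^esub> f = Mat (src f) (tgt g) (\<lambda>z x. \<Sum>y\<in>tgt f. rep g z y * rep f y x)"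
  "X \<otimes>\<^bsub>FinSetMulti\<^esub> Y = X \<times>\<^sub>e Y"
  "f \<otimes>\<^sub>m\<^bsub>FinSetMulti\<^esub> g = Mat (src f \<times>\<^sub>e src g) (tgt f \<times>\<^sub>e tgt g)
                           (\<lambda>q p. rep f (pfst q) (pfst p) * rep g (psnd q) (psnd p))"
  "I\<^bsub>FinSetMulti\<^esub> = {Point}"
  "\<alpha>\<^bsub>FinSetMulti\<^esub> X Y Z = Graph ((X \<times>\<^sub>e Y) \<times>\<^sub>e Z) (X \<times>\<^sub>e (Y \<times>\<^sub>e Z)) assoc_map"
  "lunit\<^bsub>FinSetMulti\<^esub> X = Graph ({Point} \<times>\<^sub>e X) X psnd"
  "runit\<^bsub>FinSetMulti\<^esub> X = Graph (X \<times>\<^sub>e {Point}) X pfst"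
  "\<sigma>\<^bsub>FinSetMulti\<^esub> X Y = Graph (X \<times>\<^sub>e Y) (Y \<times>\<^sub>e X) swap_map"
  "copy\<^bsub>FinSetMulti\<^esub> X = Graph X (X \<times>\<^sub>e X) copy_map"
  "del\<^bsub>FinSetMulti\<^esub> X = Graph X {Point} (\<lambda>_. Point)"
  by (simp_all add: FinSetMulti_def)

lemmas FinSetMulti_simps =
  FinSetMulti_sel FinSetMulti_Mat_Hom Mat_eq_iff Graph_def structure_maps

section \<open>The Markov category axioms for matrices\<close>

interpretation FinSetMulti: category FinSetMulti
proof
  show "f \<in> Arr FinSetMulti \<Longrightarrow> Dom FinSetMulti f \<in> Ob FinSetMulti" for f :: "'a mat_arrow"
    by (auto simp: FinSetMulti_def)
  show "f \<in> Arr FinSetMulti \<Longrightarrow> Cod FinSetMulti f \<in> Ob FinSetMulti" for f :: "'a mat_arrow"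
    by (auto simp: FinSetMulti_def)
  show "f \<cdot>\<^bsub>FinSetMulti\<^esub> id\<^bsub>FinSetMulti\<^esub> X = f"
    if "f \<in> Hom\<^bsub>FinSetMulti\<^esub> X Y" for f :: "'a mat_arrow" and X Y
    by (rule trans[OF _ FinSetMulti_HomD(5)[OF that, symmetric]])
      (use FinSetMulti_HomD(1-4)[OF that] in \<open>auto simp: FinSetMulti_simps\<close>)
  show "id\<^bsub>FinSetMulti\<^esub> Y \<cdot>\<^bsub>FinSetMulti\<^esub> f = f"
    if "f \<in> Hom\<^bsub>FinSetMulti\<^esub> X Y" for f :: "'a mat_arrow" and X Y
    by (rule trans[OF _ FinSetMulti_HomD(5)[OF that, symmetric]])
      (use FinSetMulti_HomD(1-4)[OF that] in \<open>auto simp: FinSetMulti_simps\<close>)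
  \<comment> \<open>Totality of the composite: a value of \<open>f\<close> at \<open>x\<close>
    exists, and \<open>g\<close> has a value there.\<close>
  show "g \<cdot>\<^bsub>FinSetMulti\<^esub> f \<in> Hom\<^bsub>FinSetMulti\<^esub> X Z"
    if "f \<in> Hom\<^bsub>FinSetMulti\<^esub> X Y" "g \<in> Hom\<^bsub>FinSetMulti\<^esub> Y Z"
    for f g :: "'a mat_arrow" and X Y Z
    using FinSetMulti_HomD(1-4,6)[OF that(1)] FinSetMulti_HomD(1-4,6)[OF that(2)]
    by (simp add: FinSetMulti_simps) blast
  \<comment> \<open>Both bracketings assert a path through some point of \<open>X\<close> and some
    point of \<open>Y\<close>; only the order of the existential quantifiers differs.\<close>
  show "(h \<cdot>\<^bsub>FinSetMulti\<^esub> g) \<cdot>\<^bsub>FinSetMulti\<^esub> f = h \<cdot>\<^bsub>FinSetMulti\<^esub> (g \<cdot>\<^bsub>FinSetMulti\<^esub> f)"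
    if "f \<in> Hom\<^bsub>FinSetMulti\<^esub> W X" "g \<in> Hom\<^bsub>FinSetMulti\<^esub> X Y" "h \<in> Hom\<^bsub>FinSetMulti\<^esub> Y Z"
    for f g h :: "'a mat_arrow" and W X Y Z
    using that[THEN FinSetMulti_HomD(1)] that[THEN FinSetMulti_HomD(2)]
      that[THEN FinSetMulti_HomD(3)] that[THEN FinSetMulti_HomD(4)]
    by (simp add: FinSetMulti_simps) blast
qed (auto simp: FinSetMulti_simps)

text \<open>In a composite of graphs only the intermediate point \<open>h x\<close> contributes, so
  graphs compose like their functions.\<close>

lemma FinSetMulti_isoI:
  assumes "finite X" "finite Y" "\<forall>x\<in>X. h x \<in> Y \<and> h' (h x) = x" "\<forall>y\<in>Y. h' y \<in> X \<and> h (h' y) = y"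
  shows "Iso FinSetMulti (Graph X Y h)" "Inv\<^bsub>FinSetMulti\<^esub> (Graph X Y h) = Graph Y X h'"
proof -
  have "Graph X Y h \<in> Hom\<^bsub>FinSetMulti\<^esub> X Y"
    using assms by (simp add: FinSetMulti_simps)
  then have arr: "Graph X Y h \<in> Arr FinSetMulti"
    by (simp add: Hom_def)
  have inv: "Inverse_arrows FinSetMulti (Graph X Y h) (Graph Y X h')"
    using assms by (auto simp: Inverse_arrows_def FinSetMulti_simps)
  show "Iso FinSetMulti (Graph X Y h)"
    using arr inv by (auto simp: Iso_def)
  show "Inv\<^bsub>FinSetMulti\<^esub> (Graph X Y h) = Graph Y X h'"
    using arr inv by (rule FinSetMulti.Inv_eqI)
qed

lemma FinSetMulti_assoc_iso:
  assumes "finite X" "finite Y" "finite Z"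
  shows "Iso FinSetMulti (\<alpha>\<^bsub>FinSetMulti\<^esub> X Y Z)"
    "Inv\<^bsub>FinSetMulti\<^esub> (\<alpha>\<^bsub>FinSetMulti\<^esub> X Y Z) =
       Graph (X \<times>\<^sub>e (Y \<times>\<^sub>e Z)) ((X \<times>\<^sub>e Y) \<times>\<^sub>e Z) assoc_inv_map"
  unfolding FinSetMulti_sel
  by (rule FinSetMulti_isoI[where h' = assoc_inv_map]; simp add: assms structure_maps)+

interpretation FinSetMulti: symmetric_monoidal_category FinSetMulti
proof
  show "Iso FinSetMulti (\<alpha>\<^bsub>FinSetMulti\<^esub> X Y Z)"
    if "X \<in> Ob FinSetMulti" "Y \<in> Ob FinSetMulti" "Z \<in> Ob FinSetMulti" for X Y Z :: "'a elt set"
    using that by (simp add: FinSetMulti_assoc_iso FinSetMulti_sel(1))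
  show "Iso FinSetMulti (lunit\<^bsub>FinSetMulti\<^esub> X)" if "X \<in> Ob FinSetMulti" for X :: "'a elt set"
    using that unfolding FinSetMulti_sel by (intro FinSetMulti_isoI[where h' = "Pr Point"]) auto
  show "Iso FinSetMulti (runit\<^bsub>FinSetMulti\<^esub> X)" if "X \<in> Ob FinSetMulti" for X :: "'a elt set"
    using that unfolding FinSetMulti_sel
    by (intro FinSetMulti_isoI[where h' = "\<lambda>x. Pr x Point"]) auto
  \<comment> \<open>An intermediate point in the product of \<open>Y\<close> and \<open>Y'\<close>
    is a pair of independent intermediate points, one for each factor.\<close>
  show "(g \<cdot>\<^bsub>FinSetMulti\<^esub> f) \<otimes>\<^sub>m\<^bsub>FinSetMulti\<^esub> (g' \<cdot>\<^bsub>FinSetMulti\<^esub> f') =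
      (g \<otimes>\<^sub>m\<^bsub>FinSetMulti\<^esub> g') \<cdot>\<^bsub>FinSetMulti\<^esub> (f \<otimes>\<^sub>m\<^bsub>FinSetMulti\<^esub> f')"
    if "f \<in> Hom\<^bsub>FinSetMulti\<^esub> X Y" "g \<in> Hom\<^bsub>FinSetMulti\<^esub> Y Z"
      "f' \<in> Hom\<^bsub>FinSetMulti\<^esub> X' Y'" "g' \<in> Hom\<^bsub>FinSetMulti\<^esub> Y' Z'"
    for f g f' g' :: "'a mat_arrow" and X Y Z X' Y' Z'
    using that[THEN FinSetMulti_HomD(1)] that[THEN FinSetMulti_HomD(2)]
      that[THEN FinSetMulti_HomD(3)] that[THEN FinSetMulti_HomD(4)]
    by (simp add: FinSetMulti_simps) blast
qed (auto simp: FinSetMulti_simps dest!: FinSetMulti_Hom_facts)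

interpretation FinSetMulti: markov_category FinSetMulti
proof
  show "copy\<^bsub>FinSetMulti\<^esub> (X \<otimes>\<^bsub>FinSetMulti\<^esub> Y) =
      \<mu>\<^bsub>FinSetMulti\<^esub> X X Y Y \<cdot>\<^bsub>FinSetMulti\<^esub>
        (copy\<^bsub>FinSetMulti\<^esub> X \<otimes>\<^sub>m\<^bsub>FinSetMulti\<^esub> copy\<^bsub>FinSetMulti\<^esub> Y)"
    if "X \<in> Ob FinSetMulti" "Y \<in> Ob FinSetMulti" for X Y :: "'a elt set"
    using that unfolding Middle_swap_def
    by (simp add: FinSetMulti_assoc_iso FinSetMulti_sel(1,6)) (auto simp: FinSetMulti_simps)
qed (auto simp: FinSetMulti_simps dest!: FinSetMulti_Hom_facts)

section \<open>Conditionals for matrices\<close>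

lemma FinSetMulti_has_conditionals: "has_conditionals FinSetMulti"
  unfolding has_conditionals_def
proof (intro ballI)
  fix A X Y :: "'a elt set" and f
  assume "f \<in> Hom\<^bsub>FinSetMulti\<^esub> A (X \<otimes>\<^bsub>FinSetMulti\<^esub> Y)"
    and fin: "A \<in> Ob FinSetMulti" "X \<in> Ob FinSetMulti" "Y \<in> Ob FinSetMulti"
  then have f: "f \<in> Hom\<^bsub>FinSetMulti\<^esub> A (X \<times>\<^sub>e Y)"
    by (simp add: FinSetMulti_sel)
  have total: "\<forall>a\<in>A. \<exists>x\<in>X. \<exists>y\<in>Y. rep f (Pr x y) a = 1"
    using FinSetMulti_HomD(6)[OF f] by simp
  \<comment> \<open>The default 1 serves only to keep \<open>?k\<close> total: it applies at those
    \<open>(x, a)\<close> where the marginal entry of \<open>f\<close> is 0, so it never reaches the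
    composite.\<close>
  let ?k = "Mat (X \<times>\<^sub>e A) Y (\<lambda>y p.
    if \<exists>y'\<in>Y. rep f (Pr (pfst p) y') (psnd p) = 1 then rep f (Pr (pfst p) y) (psnd p) else 1)"
  show "\<exists>k \<in> Hom\<^bsub>FinSetMulti\<^esub> (X \<otimes>\<^bsub>FinSetMulti\<^esub> A) Y.
      f = (id\<^bsub>FinSetMulti\<^esub> X \<otimes>\<^sub>m\<^bsub>FinSetMulti\<^esub> k) \<cdot>\<^bsub>FinSetMulti\<^esub> \<alpha>\<^bsub>FinSetMulti\<^esub> X X A \<cdot>\<^bsub>FinSetMulti\<^esub>
        (copy\<^bsub>FinSetMulti\<^esub> X \<otimes>\<^sub>m\<^bsub>FinSetMulti\<^esub> id\<^bsub>FinSetMulti\<^esub> A) \<cdot>\<^bsub>FinSetMulti\<^esub>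
        (Marginal FinSetMulti X Y f \<otimes>\<^sub>m\<^bsub>FinSetMulti\<^esub> id\<^bsub>FinSetMulti\<^esub> A) \<cdot>\<^bsub>FinSetMulti\<^esub>
        copy\<^bsub>FinSetMulti\<^esub> A"
  proof (rule bexI)
    show "?k \<in> Hom\<^bsub>FinSetMulti\<^esub> (X \<otimes>\<^bsub>FinSetMulti\<^esub> A) Y"
      \<comment> \<open>In the default case any point of \<open>Y\<close> is a value;
        \<open>total\<close> at \<open>a\<close> supplies one, possibly paired with a different
        point of \<open>X\<close>.\<close>
      using fin total by (simp add: FinSetMulti_simps) blast
    show "f = (id\<^bsub>FinSetMulti\<^esub> X \<otimes>\<^sub>m\<^bsub>FinSetMulti\<^esub> ?k) \<cdot>\<^bsub>FinSetMulti\<^esub> \<alpha>\<^bsub>FinSetMulti\<^esub> X X A \<cdot>\<^bsub>FinSetMulti\<^esub>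
        (copy\<^bsub>FinSetMulti\<^esub> X \<otimes>\<^sub>m\<^bsub>FinSetMulti\<^esub> id\<^bsub>FinSetMulti\<^esub> A) \<cdot>\<^bsub>FinSetMulti\<^esub>
        (Marginal FinSetMulti X Y f \<otimes>\<^sub>m\<^bsub>FinSetMulti\<^esub> id\<^bsub>FinSetMulti\<^esub> A) \<cdot>\<^bsub>FinSetMulti\<^esub>
        copy\<^bsub>FinSetMulti\<^esub> A"
      \<comment> \<open>The composite has entry 1 at \<open>(x, y)\<close> and \<open>a\<close> iff
        \<open>f\<close> relates \<open>a\<close> to some \<open>(x, y')\<close> and
        \<open>?k\<close> relates \<open>(x, a)\<close> to \<open>y\<close>. The first condition
        selects the branch of \<open>?k\<close> that copies \<open>f\<close>; conversely
        \<open>y\<close> itself can serve as \<open>y'\<close>.\<close>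
      by (rule trans[OF FinSetMulti_HomD(5)[OF f]])
        (use FinSetMulti_HomD(1-4)[OF f] fin in \<open>auto simp: FinSetMulti_simps Marginal_def\<close>)
  qed
qed

theorem proposition16:
  shows "(markov_category (FinSet :: ('a elt set, 'a fun_arrow) markov_data) \<and>
          has_conditionals (FinSet :: ('a elt set, 'a fun_arrow) markov_data)) \<and>
         (markov_category (FinSetMulti :: ('a elt set, 'a mat_arrow) markov_data) \<and>
          has_conditionals (FinSetMulti :: ('a elt set, 'a mat_arrow) markov_data))"
  by (intro conjI FinSet.markov_category_axioms FinSet_has_conditionals
      FinSetMulti.markov_category_axioms FinSetMulti_has_conditionals)

end
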